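(* Let $m,n\in\mathbb{N}$, $a,b,c\in\mathbb{Z}$ with $a\neq0$, $b\neq0$ and $c\neq0$. Then, for $x,y,z\in\mathbb{R}$, \begin{align*} s_{m,n}\begin{pmatrix} a & b & c \\ x & y & z\end{pmatrix} &=nb^{n-1}\mathrm{sgn}(bc)\sum_{j=0}^{m}\binom{m}{j}\frac{(-1)^{m+n-j}a^{m-j}}{c^{m+n-j-1}(m+n-j)}\,s_{j,m+n-j}\begin{pmatrix} a & c & b \\ x & z & y\end{pmatrix}\\ &\quad+ma^{m-1}\mathrm{sgn}(ac)\sum_{j=0}^{n}\binom{n}{j}\frac{(-1)^{m+n-j}b^{n-j}}{c^{m+n-j-1}(m+n-j)}\,s_{j,m+n-j}\begin{pmatrix} b & c & a \\ y & z & x\end{pmatrix}\\ &\quad+\frac{(-1)^{n-1}m!\,n!\,c\,(a,b)^{m+n}\mathrm{sgn}(c)\,\overline{B}_{m+n}\bigl(\frac{ay-bx}{(a,b)}\bigr)}{a^{n}b^{m}(m+n)!}-\delta_{1,m}\delta_{1,n}\mathrm{sgn}(ab)\frac{\widetilde{N}}{4}, \end{align*} where $\widetilde{N}$ is the number of distinct triples $r,s,t\in\mathbb{Z}$ such that $0\leq\mathrm{sgn}(c)\frac{r+x}{a}=\mathrm{sgn}(c)\frac{s+y}{b}=\mathrm{sgn}(c)\frac{t+z}{c}<1$.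
   Context: Notation: $\{x\}$ is the fractional part of $x$. The Bernoulli functions are $\overline{B}_0(x)=1$, $\overline{B}_1(x)=((x))$ (equal to $\{x\}-\tfrac12$ if $x\notin\mathbb{Z}$ and $0$ if $x\in\mathbb{Z}$), and $\overline{B}_n(x)=B_n(\{x\})$ for $n\geq2$, where $B_n$ is the $n$-th Bernoulli polynomial. For $m,n\in\mathbb{N}_0$, $a,b,c\in\mathbb{Z}$, $x,y,z\in\mathbb{R}$ with $c\neq0$, the generalized Dedekind–Rademacher sums (Hall–Wilson–Zagier) are $s_{m,n}\begin{pmatrix} a & b & c \\ x & y & z\end{pmatrix}=\sum_{r=1}^{|c|}\overline{B}_{m}\bigl(\frac{a(r+z)}{c}-x\bigr)\overline{B}_{n}\bigl(\frac{b(r+z)}{c}-y\bigr)$. $(a,b)$ denotes the greatest common divisor of $a,b$; $\mathrm{sgn}$ is the sign function; $\delta_{l,k}$ is the Kronecker delta. *)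

theory Defs
  imports "HOL-Analysis.Analysis"
begin

(* Convention B_1 = -1/2, i.e. generating function t / (exp t - 1). *)
fun bernoulli_num :: "nat \<Rightarrow> real" where
  "bernoulli_num 0 = 1"
| "bernoulli_num (Suc n) =
     - (\<Sum>k\<le>n. real ((n + 2) choose k) * bernoulli_num k) / real (n + 2)"

definition bernoulli_poly :: "nat \<Rightarrow> real \<Rightarrow> real" where
  "bernoulli_poly n x = (\<Sum>k\<le>n. real (n choose k) * bernoulli_num k * x ^ (n - k))"

definition sawtooth :: "real \<Rightarrow> real" where
  "sawtooth x = (if x \<in> \<int> then 0 else frac x - 1 / 2)"

definition bernoulli_fun :: "nat \<Rightarrow> real \<Rightarrow> real" where
  "bernoulli_fun n x =
     (if n = 0 then 1 else if n = 1 then sawtooth x else bernoulli_poly n (frac x))"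

(* dr_sum m n a b c x y z lists the parameters of the 2x3 array row by row. *)
definition dr_sum ::
  "nat \<Rightarrow> nat \<Rightarrow> int \<Rightarrow> int \<Rightarrow> int \<Rightarrow> real \<Rightarrow> real \<Rightarrow> real \<Rightarrow> real" where
  "dr_sum m n a b c x y z =
     (\<Sum>r = 1..\<bar>c\<bar>.
        bernoulli_fun m (of_int a * (of_int r + z) / of_int c - x) *
        bernoulli_fun n (of_int b * (of_int r + z) / of_int c - y))"

definition kronecker :: "nat \<Rightarrow> nat \<Rightarrow> real" where
  "kronecker i j = (if i = j then 1 else 0)"

(* For nonzero a, b, c the set is finite: t ranges over finitely many values and
   determines r and s. *)
definition triple_count ::
  "int \<Rightarrow> int \<Rightarrow> int \<Rightarrow> real \<Rightarrow> real \<Rightarrow> real \<Rightarrow> nat" where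
  "triple_count a b c x y z =
     card {(r :: int, s :: int, t :: int).
       0 \<le> of_int (sgn c) * ((of_int r + x) / of_int a) \<and>
       of_int (sgn c) * ((of_int r + x) / of_int a) =
         of_int (sgn c) * ((of_int s + y) / of_int b) \<and>
       of_int (sgn c) * ((of_int s + y) / of_int b) =
         of_int (sgn c) * ((of_int t + z) / of_int c) \<and>
       of_int (sgn c) * ((of_int t + z) / of_int c) < 1}"

end

theory Submission
  imports Defs "HOL-Computational_Algebra.Computational_Algebra"
begin

text \<open>
  Choose weights with a\<alpha> + b\<beta> + c\<gamma> = 0. Then the formal exponential of
  \<alpha>{au - x} + \<beta>{bu - y} + \<gamma>{cu - z} is a step function of u of period 1, so its jumps over a
  period add up to zero. The jumps sit at the points where au - x, bu - y or cu - z is an integer,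
  and dividing by the product of the three series exp(\<alpha>X) - 1, exp(\<beta>X) - 1, exp(\<gamma>X) - 1 turns the jumps
  into generating functions of products of two Bernoulli functions. The convention that the first Bernoulli
  function takes its mean value at integers accounts for coinciding points, up to a term
  counting the triple coincidences. Substituting \<gamma> = -(a\<alpha> + b\<beta>)/c, dividing by \<gamma> and comparing
  coefficients of \<alpha>^m \<beta>^n gives the theorem; the terms without a factor \<gamma> are evaluated by
  the multiplication theorem for Bernoulli functions and yield the gcd term.
\<close>

subsection \<open>Jumps of step functions and sums over grids\<close>

text \<open>\<open>R\<close> and \<open>L\<close> play the one-sided limits of a step function with
  jump set \<open>D\<close>. Induction removes the least jump point \<open>s\<close>, where
  \<open>L s = R p\<close> because nothing jumps in between. The half-open interval counts a jump at
  \<open>q\<close> but none at \<open>p\<close>.\<close>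

lemma sum_jumps_eq_diff:
  fixes R L :: "real \<Rightarrow> 'a::ab_group_add"
  assumes "finite (D \<inter> {p<..q})" and "p \<le> q"
    and const: "\<And>p q. p < q \<Longrightarrow> D \<inter> {p<..<q} = {} \<Longrightarrow> L q = R p"
    and cont: "\<And>q. q \<notin> D \<Longrightarrow> L q = R q"
  shows "(\<Sum>u\<in>D \<inter> {p<..q}. R u - L u) = R q - R p"
  using assms(1,2)
proof (induction "card (D \<inter> {p<..q})" arbitrary: p)
  case 0
  then have empty: "D \<inter> {p<..q} = {}" by simp
  have "R q = R p"
  proof (cases "p = q")
    case False
    with 0 have "p < q" by simp
    moreover from empty have "D \<inter> {p<..<q} = {}" by force
    ultimately have "L q = R p" by (rule const)
    moreover have "q \<notin> D" using empty \<open>p < q\<close> by auto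
    ultimately show ?thesis using cont by simp
  qed simp
  then show ?case by (simp only: empty sum.empty diff_self)
next
  case (Suc k)
  define s where "s = Min (D \<inter> {p<..q})"
  have ne: "D \<inter> {p<..q} \<noteq> {}" using Suc.hyps(2) by auto
  have s: "s \<in> D" "p < s" "s \<le> q" using Min_in[OF Suc.prems(1) ne] by (auto simp: s_def)
  have least: "s \<le> u" if "u \<in> D" "p < u" "u \<le> q" for u
    unfolding s_def using that Suc.prems(1) by (intro Min_le) auto
  have split: "D \<inter> {p<..q} = insert s (D \<inter> {s<..q})"
    using s least by force
  have fin: "finite (D \<inter> {s<..q})" using Suc.prems(1) split by simp
  have "k = card (D \<inter> {s<..q})" using Suc.hyps(2) fin by (simp add: split)
  then have "(\<Sum>u\<in>D \<inter> {s<..q}. R u - L u) = R q - R s"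
    using Suc.hyps(1) fin s by blast
  moreover have "L s = R p" using s least by (intro const) force+
  ultimately show ?case using fin by (simp add: split)
qed

section \<open>Sums of periodic functions over windows of integers\<close>

lemma sum_periodic_int:
  fixes f :: "int \<Rightarrow> 'a::comm_monoid_add"
  assumes "k > 0" and per: "\<And>r. f (r + k) = f r"
  shows "sum f {i..<i + k} = sum f {j..<j + k}"
proof -
  have step: "sum f {i..<i + k} = sum f {i + 1..<i + 1 + k}" for i
  proof -
    have "{i..<i + k} = insert i {i + 1..<i + k}"
      and "{i + 1..<i + 1 + k} = insert (i + k) {i + 1..<i + k}"
      using \<open>k > 0\<close> by auto
    then show ?thesis by (simp add: per)
  qed
  have "sum f {i..<i + k} = sum f {0..<0 + k}" for i
  proof (induction i rule: int_induct[where k = 0])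
    case (step1 i)
    then show ?case using step[of i] by simp
  next
    case (step2 i)
    then show ?case using step[of "i - 1"] by simp
  qed simp
  then show ?thesis by metis
qed

text \<open>Each set is a window of \<open>k\<close> consecutive integers. The first and third serve
  the grid points in (0, 1] for positive and negative modulus, the second serves the triple
  count.\<close>

lemma int_interval_eq:
  fixes z :: real
  shows "{r::int. 0 < of_int r + z \<and> of_int r + z \<le> of_int k} = {\<lfloor>- z\<rfloor> + 1..<\<lfloor>- z\<rfloor> + 1 + k}"
    and "{r::int. 0 \<le> of_int r + z \<and> of_int r + z < of_int k} = {\<lceil>- z\<rceil>..<\<lceil>- z\<rceil> + k}"
    and "{r::int. - of_int k \<le> of_int r + z \<and> of_int r + z < 0} = {\<lceil>- z\<rceil> - k..<\<lceil>- z\<rceil> - k + k}"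
  by (auto; linarith)+

section \<open>Grids of jump points\<close>

definition grid :: "int \<Rightarrow> real \<Rightarrow> real set" where
  "grid a x = {u. of_int a * u - x \<in> \<int>}"

lemma grid_eq_image:
  assumes "a \<noteq> 0"
  shows "grid a x = (\<lambda>r::int. (of_int r + x) / of_int a) ` UNIV"
proof -
  have "u \<in> (\<lambda>r::int. (of_int r + x) / of_int a) ` UNIV" if "of_int a * u - x = of_int r" for u r
    using that assms by (intro image_eqI[of _ _ r]) (auto simp: field_simps)
  then show ?thesis using assms by (auto simp: grid_def elim!: Ints_cases)
qed

lemma grid_unit_interval:
  assumes "a \<noteq> 0"
  obtains i where "grid a x \<inter> {0<..1} = (\<lambda>r::int. (of_int r + x) / of_int a) ` {i..<i + \<bar>a\<bar>}"
proof (cases "a > 0")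
  case True
  then have "grid a x \<inter> {0<..1} = (\<lambda>r::int. (of_int r + x) / of_int a) `
      {r::int. 0 < of_int r + x \<and> of_int r + x \<le> of_int a}"
    using assms by (auto simp: grid_eq_image field_simps)
  with that True show ?thesis unfolding int_interval_eq by (metis abs_of_pos)
next
  case False
  then have "grid a x \<inter> {0<..1} = (\<lambda>r::int. (of_int r + x) / of_int a) `
      {r::int. - of_int (- a) \<le> of_int r + x \<and> of_int r + x < 0}"
    using assms by (auto simp: grid_eq_image field_simps)
  with that False show ?thesis unfolding int_interval_eq by (metis abs_of_nonpos linorder_not_less)
qed

lemma finite_grid: "a \<noteq> 0 \<Longrightarrow> finite (grid a x \<inter> {0<..1})"
  by (rule grid_unit_interval[of a x]) auto

text \<open>The grid points in (0, 1] come from \<bar>a\<bar> consecutive \<open>r\<close>, and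
  adding \<open>a\<close> to \<open>r\<close> moves the point by 1, so any other window of that
  length gives the same sum.\<close>

lemma sum_grid:
  fixes F :: "real \<Rightarrow> 'a::comm_monoid_add"
  assumes "a \<noteq> 0" and per: "\<And>u. F (u + 1) = F u"
  shows "(\<Sum>u\<in>grid a x \<inter> {0<..1}. F u) = (\<Sum>r = 1..\<bar>a\<bar>. F ((of_int r + x) / of_int a))"
proof -
  obtain i where i: "grid a x \<inter> {0<..1} = (\<lambda>r::int. (of_int r + x) / of_int a) ` {i..<i + \<bar>a\<bar>}"
    using grid_unit_interval[OF assms(1)] .
  have "inj (\<lambda>r::int. (of_int r + x) / of_int a)"
    using assms(1) by (auto simp: inj_on_def)
  then have "(\<Sum>u\<in>grid a x \<inter> {0<..1}. F u) = (\<Sum>r\<in>{i..<i + \<bar>a\<bar>}. F ((of_int r + x) / of_int a))"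
    unfolding i by (subst sum.reindex) (auto intro: inj_on_subset)
  also have "\<dots> = (\<Sum>r\<in>{1..<1 + \<bar>a\<bar>}. F ((of_int r + x) / of_int a))"
  proof (rule sum_periodic_int)
    fix r :: int
    have "F ((of_int (r + a) + x) / of_int a) = F ((of_int r + x) / of_int a)" for r
      using per[of "(of_int r + x) / of_int a"] assms(1) by (simp add: field_simps)
    from this[of r] this[of "r - a"]
    show "F ((of_int (r + \<bar>a\<bar>) + x) / of_int a) = F ((of_int r + x) / of_int a)"
      by (cases "a > 0") auto
  qed (use assms in simp)
  also have "{1..<1 + \<bar>a\<bar>} = {1..\<bar>a\<bar>}" by auto
  finally show ?thesis .
qed

lemma Ints_add_of_int_iff: "v + of_int k \<in> \<int> \<longleftrightarrow> (v::real) \<in> \<int>"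
  by (metis Ints_add Ints_diff Ints_of_int add_diff_cancel_right')

subsection \<open>One-sided fractional parts and the jump relation\<close>

text \<open>The left-continuous version of \<open>frac\<close>: it takes values in (0, 1] and equals
  1 at integers.\<close>

definition upper_frac :: "real \<Rightarrow> real" where
  "upper_frac v = v - of_int \<lceil>v\<rceil> + 1"

lemma upper_frac_add_int [simp]: "upper_frac (v + of_int k) = upper_frac v"
  by (simp add: upper_frac_def)

lemma upper_frac_Ints: "v \<in> \<int> \<Longrightarrow> upper_frac v = 1"
  by (auto simp: upper_frac_def elim!: Ints_cases)

lemma upper_frac_not_Ints: "v \<notin> \<int> \<Longrightarrow> upper_frac v = frac v"
  by (simp add: upper_frac_def frac_def ceiling_altdef) (metis Ints_of_int)

lemma upper_frac_minus: "upper_frac (- v) = 1 - frac v"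
  by (simp add: upper_frac_def frac_def ceiling_minus)

lemma frac_minus: "frac (- v) = 1 - upper_frac v"
  by (simp add: upper_frac_def frac_def floor_minus)

text \<open>With no integer strictly between \<open>v\<close> and \<open>w\<close>, the ceiling of
  \<open>w\<close> is one more than the floor of \<open>v\<close>.\<close>

lemma upper_frac_minus_frac:
  assumes "v < w" and "\<And>k::int. \<not> (v < of_int k \<and> of_int k < w)"
  shows "upper_frac w - frac v = w - v"
proof -
  have "\<lceil>w\<rceil> = \<lfloor>v\<rfloor> + 1"
    using assms(1) assms(2)[of "\<lfloor>v\<rfloor> + 1"]
    by (intro ceiling_unique) (auto, linarith+)
  then show ?thesis by (simp add: upper_frac_def frac_def)
qed

text \<open>The limit of the fractional part of a u - x as u approaches from the right;
  \<open>left_frac\<close> is the limit from the left. For negative \<open>a\<close> the argument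
  decreases as u grows, which exchanges the two.\<close>

definition right_frac :: "int \<Rightarrow> real \<Rightarrow> real" where
  "right_frac a v = (if a > 0 then frac v else upper_frac v)"

definition left_frac :: "int \<Rightarrow> real \<Rightarrow> real" where
  "left_frac a v = (if a > 0 then upper_frac v else frac v)"

text \<open>Between grid points the fractional part is linear with slope \<open>a\<close>. For
  negative \<open>a\<close> the points \<open>p\<close> and \<open>q\<close> exchange roles.\<close>

lemma left_frac_minus_right_frac:
  assumes "a \<noteq> 0" and "p < q" and "grid a x \<inter> {p<..<q} = {}"
  shows "left_frac a (of_int a * q - x) = right_frac a (of_int a * p - x) + of_int a * (q - p)"
proof -
  have "(of_int k + x) / of_int a \<in> grid a x" for k :: int
    using assms(1) by (simp add: grid_eq_image)
  then have no: "\<not> (p < (of_int k + x) / of_int a \<and> (of_int k + x) / of_int a < q)" for k :: int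
    using assms(3) by (meson IntI disjoint_iff greaterThanLessThan_iff)
  show ?thesis
  proof (cases "a > 0")
    case True
    have "upper_frac (of_int a * q - x) - frac (of_int a * p - x) = (of_int a * q - x) - (of_int a * p - x)"
      using True assms(2) no by (intro upper_frac_minus_frac) (auto simp: field_simps)
    then show ?thesis using True by (simp add: left_frac_def right_frac_def algebra_simps)
  next
    case False
    have "upper_frac (of_int a * p - x) - frac (of_int a * q - x) = (of_int a * p - x) - (of_int a * q - x)"
      using False assms(1,2) no by (intro upper_frac_minus_frac) (auto simp: field_simps)
    then show ?thesis using False by (simp add: left_frac_def right_frac_def algebra_simps)
  qed
qed

lemma left_frac_eq_right_frac: "v \<notin> \<int> \<Longrightarrow> left_frac a v = right_frac a v"
  by (simp add: left_frac_def right_frac_def upper_frac_not_Ints)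

text \<open>At an integer the one-sided values are 0 and 1, so the exponentials are 1 and
  exp(\<alpha>X); the sign of \<open>a\<close> decides which side is which. Elsewhere nothing
  jumps.\<close>

lemma exp_frac_jump:
  assumes "a \<noteq> 0"
  shows "fps_exp (\<alpha> * right_frac a v) - fps_exp (\<alpha> * left_frac a v)
    = fps_const (- of_int (sgn a) * of_bool (v \<in> \<int>)) * (fps_exp \<alpha> - 1)"
proof (cases "v \<in> \<int>")
  case True
  then show ?thesis using assms
    by (cases "a > 0") (auto simp: right_frac_def left_frac_def upper_frac_Ints simp flip: fps_const_neg)
next
  case False
  then show ?thesis by (simp add: left_frac_eq_right_frac)
qed

text \<open>Averaging the one-sided limits is the exponential counterpart of giving the sawtooth its
  mean value 0 at integers.\<close>

definition mean_exp :: "real \<Rightarrow> real \<Rightarrow> real fps" where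
  "mean_exp \<alpha> v = fps_const (1/2) * (fps_exp (\<alpha> * frac v) + fps_exp (\<alpha> * upper_frac v))"

lemma mean_exp_conv_sides:
  "mean_exp \<alpha> v = fps_const (1/2) * (fps_exp (\<alpha> * right_frac a v) + fps_exp (\<alpha> * left_frac a v))"
  by (simp add: mean_exp_def right_frac_def left_frac_def add.commute)

lemma mean_exp_add_int [simp]: "mean_exp \<alpha> (v + of_int k) = mean_exp \<alpha> v"
  by (simp add: mean_exp_def)

lemma mean_exp_0 [simp]: "mean_exp 0 v = 1"
proof -
  have "mean_exp 0 v = fps_const (1/2) * fps_const 2" by (simp add: mean_exp_def numeral_fps_const)
  then show ?thesis by (simp only: fps_const_mult) simp
qed

text \<open>Negation turns \<open>frac\<close> into 1 - \<open>upper_frac\<close> and conversely,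
  and the mean is symmetric in the two. This yields the parity of the Bernoulli functions.\<close>

lemma mean_exp_minus: "mean_exp \<alpha> (- v) = fps_exp \<alpha> * mean_exp (- \<alpha>) v"
proof -
  have "fps_exp (\<alpha> * (1 - w)) = fps_exp \<alpha> * fps_exp (- \<alpha> * w)" for w
    by (simp add: right_diff_distrib flip: fps_exp_add_mult)
  then show ?thesis
    by (simp only: mean_exp_def frac_minus upper_frac_minus distrib_left mult.left_commute add.commute)
qed

text \<open>Writing each pair as r = f + d/2, l = f - d/2, the terms with an even number of factors d
  cancel. The cubic term is the source of the triple count.\<close>

lemma product_jump:
  fixes r1 r2 r3 l1 l2 l3 :: "real fps"
  defines "h \<equiv> fps_const (1/2)"
  shows "r1 * r2 * r3 - l1 * l2 * l3 =
      (h * (r1 + l1)) * (h * (r2 + l2)) * (r3 - l3)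
    + (h * (r2 + l2)) * (h * (r3 + l3)) * (r1 - l1)
    + (h * (r1 + l1)) * (h * (r3 + l3)) * (r2 - l2)
    + fps_const (1/4) * ((r1 - l1) * (r2 - l2) * (r3 - l3))"
proof -
  have h: "h * 2 = 1" by (simp add: h_def numeral_fps_const)
  have "fps_const (1/4) = h * h" by (simp add: h_def)
  with h show ?thesis by algebra
qed

lemma right_frac_add_int [simp]: "right_frac a (v + of_int k) = right_frac a v"
  by (simp add: right_frac_def)

text \<open>The total jump over a period is zero. \<open>product_jump\<close> sorts the jumps: each
  linear term lives on one of the three grids, the cubic term on their intersection, which
  \<open>N\<close> counts. Zero weights are allowed, which the multiplication theorem
  exploits.\<close>

lemma exp_reciprocity:
  fixes a b c :: int and x y z \<alpha> \<beta> \<gamma> :: real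
  assumes nz: "a \<noteq> 0" "b \<noteq> 0" "c \<noteq> 0"
    and rel: "of_int a * \<alpha> + of_int b * \<beta> + of_int c * \<gamma> = 0"
  defines "N \<equiv> (\<Sum>r = 1..\<bar>c\<bar>. of_bool (of_int a * (of_int r + z) / of_int c - x \<in> \<int> \<and>
                              of_int b * (of_int r + z) / of_int c - y \<in> \<int>) :: real)"
  shows
    "fps_const (of_int (sgn c)) * (fps_exp \<gamma> - 1) * (\<Sum>r = 1..\<bar>c\<bar>.
        mean_exp \<alpha> (of_int a * (of_int r + z) / of_int c - x) *
        mean_exp \<beta> (of_int b * (of_int r + z) / of_int c - y))
   + fps_const (of_int (sgn a)) * (fps_exp \<alpha> - 1) * (\<Sum>r = 1..\<bar>a\<bar>.
        mean_exp \<beta> (of_int b * (of_int r + x) / of_int a - y) *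
        mean_exp \<gamma> (of_int c * (of_int r + x) / of_int a - z))
   + fps_const (of_int (sgn b)) * (fps_exp \<beta> - 1) * (\<Sum>r = 1..\<bar>b\<bar>.
        mean_exp \<alpha> (of_int a * (of_int r + y) / of_int b - x) *
        mean_exp \<gamma> (of_int c * (of_int r + y) / of_int b - z))
   + fps_const (of_int (sgn (a * b * c)) * N / 4) *
       ((fps_exp \<alpha> - 1) * (fps_exp \<beta> - 1) * (fps_exp \<gamma> - 1)) = 0"
    (is "?C + ?A + ?B + ?T = 0")
proof -
  define A B C where "A u = of_int a * u - x" and "B u = of_int b * u - y"
    and "C u = of_int c * u - z" for u
  define R where "R u = fps_exp (\<alpha> * right_frac a (A u)) * fps_exp (\<beta> * right_frac b (B u))
    * fps_exp (\<gamma> * right_frac c (C u))" for u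
  define L where "L u = fps_exp (\<alpha> * left_frac a (A u)) * fps_exp (\<beta> * left_frac b (B u))
    * fps_exp (\<gamma> * left_frac c (C u))" for u
  define D where "D = grid a x \<union> grid b y \<union> grid c z"
  have fin: "finite (D \<inter> {0<..1})"
    using nz finite_grid by (simp add: D_def Int_Un_distrib2)
  have A_per: "A (u + 1) = A u + of_int a" and B_per: "B (u + 1) = B u + of_int b"
    and C_per: "C (u + 1) = C u + of_int c" for u
    by (simp_all add: A_def B_def C_def algebra_simps)

  have "(\<Sum>u\<in>D \<inter> {0<..1}. R u - L u) = R 1 - R 0"
  proof (rule sum_jumps_eq_diff)
    fix p q :: real assume "p < q" and disj: "D \<inter> {p<..<q} = {}"
    have "left_frac a (A q) = right_frac a (A p) + of_int a * (q - p)"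
      "left_frac b (B q) = right_frac b (B p) + of_int b * (q - p)"
      "left_frac c (C q) = right_frac c (C p) + of_int c * (q - p)"
      unfolding A_def B_def C_def using nz \<open>p < q\<close> disj
      by (intro left_frac_minus_right_frac; auto simp: D_def)+
    \<comment> \<open>The weighted slopes add up to the left side of \<open>rel\<close>, so the
      product is constant between jump points.\<close>
    then have "\<alpha> * left_frac a (A q) + \<beta> * left_frac b (B q) + \<gamma> * left_frac c (C q)
      = \<alpha> * right_frac a (A p) + \<beta> * right_frac b (B p) + \<gamma> * right_frac c (C p)
        + (of_int a * \<alpha> + of_int b * \<beta> + of_int c * \<gamma>) * (q - p)"
      by algebra
    then show "L q = R p"
      using rel by (simp add: L_def R_def flip: fps_exp_add_mult)
  next
    fix q assume "q \<notin> D"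
    then show "L q = R q"
      by (simp add: L_def R_def D_def grid_def A_def B_def C_def left_frac_eq_right_frac)
  qed (use fin in auto)
  \<comment> \<open>Over one period the three arguments change by the integers \<open>a\<close>,
    \<open>b\<close>, \<open>c\<close>.\<close>
  also have "R 1 = R 0"
    using A_per[of 0] B_per[of 0] C_per[of 0] by (simp add: R_def)
  finally have sum0: "(\<Sum>u\<in>D \<inter> {0<..1}. R u - L u) = 0" by simp

  define e where "e \<delta> = fps_exp \<delta> - 1" for \<delta> :: real
  define FC where "FC u = mean_exp \<alpha> (A u) * mean_exp \<beta> (B u)" for u
  define FA where "FA u = mean_exp \<beta> (B u) * mean_exp \<gamma> (C u)" for u
  define FB where "FB u = mean_exp \<alpha> (A u) * mean_exp \<gamma> (C u)" for u
  define I where "I k w u = (if u \<in> grid k w then 1 else 0 :: real fps)" for k w u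
  \<comment> \<open>Two indicators suffice: the third is the factor \<open>I c z u\<close> in
    \<open>RL\<close>, so the sum can be restricted to the grid of \<open>c\<close>.\<close>
  define FT where "FT u = I a x u * I b y u" for u
  have jump: "fps_exp (\<delta> * right_frac k (of_int k * u - w)) - fps_exp (\<delta> * left_frac k (of_int k * u - w))
      = - (fps_const (of_int (sgn k)) * e \<delta> * I k w u)" if "k \<noteq> 0" for \<delta> k u w
    unfolding exp_frac_jump[OF that] by (auto simp: e_def I_def grid_def simp flip: fps_const_neg)
  have RL: "R u - L u = - (fps_const (of_int (sgn c)) * e \<gamma> * (FC u * I c z u)
      + fps_const (of_int (sgn a)) * e \<alpha> * (FA u * I a x u)
      + fps_const (of_int (sgn b)) * e \<beta> * (FB u * I b y u)
      + fps_const (of_int (sgn (a * b * c)) / 4) * (e \<alpha> * e \<beta> * e \<gamma>) * (FT u * I c z u))" for u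
  proof -
    have sg: "fps_const (of_int (sgn (a * b * c)) / 4) = fps_const (1/4 :: real) * (fps_const (of_int (sgn a))
      * fps_const (of_int (sgn b)) * fps_const (of_int (sgn c)))"
      by (simp add: sgn_mult)
    show ?thesis
      unfolding R_def L_def
      by (subst product_jump, fold mean_exp_conv_sides,
          simp only: A_def B_def C_def jump[OF nz(1)] jump[OF nz(2)] jump[OF nz(3)] FA_def FB_def FC_def FT_def sg)
        (simp add: algebra_simps)
  qed
  have restrict: "(\<Sum>u\<in>D \<inter> {0<..1}. F u * I k w u) = (\<Sum>r = 1..\<bar>k\<bar>. F ((of_int r + w) / of_int k))"
    if "k \<noteq> 0" "grid k w \<subseteq> D" "\<And>u. F (u + 1) = F u" for F k w
  proof -
    have "(\<Sum>u\<in>D \<inter> {0<..1}. F u * I k w u) = (\<Sum>u\<in>grid k w \<inter> {0<..1}. F u)"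
      using that(2) fin by (intro sum.mono_neutral_cong_right) (auto simp: I_def)
    also have "\<dots> = (\<Sum>r = 1..\<bar>k\<bar>. F ((of_int r + w) / of_int k))"
      using that(1,3) by (rule sum_grid)
    finally show ?thesis .
  qed
  have "?C + ?A + ?B + ?T = - (\<Sum>u\<in>D \<inter> {0<..1}. R u - L u)"
  proof -
    have C: "(\<Sum>u\<in>D \<inter> {0<..1}. FC u * I c z u) = (\<Sum>r = 1..\<bar>c\<bar>. FC ((of_int r + z) / of_int c))"
      by (rule restrict) (auto simp: nz D_def FC_def A_per B_per)
    have A: "(\<Sum>u\<in>D \<inter> {0<..1}. FA u * I a x u) = (\<Sum>r = 1..\<bar>a\<bar>. FA ((of_int r + x) / of_int a))"
      by (rule restrict) (auto simp: nz D_def FA_def C_per B_per)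
    have B: "(\<Sum>u\<in>D \<inter> {0<..1}. FB u * I b y u) = (\<Sum>r = 1..\<bar>b\<bar>. FB ((of_int r + y) / of_int b))"
      by (rule restrict) (auto simp: nz D_def FB_def A_per C_per)
    have I_per: "I a x (u + 1) = I a x u" "I b y (u + 1) = I b y u" for u
      unfolding I_def grid_def mem_Collect_eq A_def[symmetric] B_def[symmetric] A_per B_per Ints_add_of_int_iff
      by (rule refl)+
    have "(\<Sum>u\<in>D \<inter> {0<..1}. FT u * I c z u) = (\<Sum>r = 1..\<bar>c\<bar>. FT ((of_int r + z) / of_int c))"
      by (rule restrict) (auto simp: nz D_def FT_def I_per)
    also have "\<dots> = fps_const N"
    proof -
      have "FT ((of_int r + z) / of_int c) = fps_const (of_bool (of_int a * (of_int r + z) / of_int c - x \<in> \<int> \<and>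
          of_int b * (of_int r + z) / of_int c - y \<in> \<int>))" for r
        by (auto simp: FT_def I_def grid_def)
      then show ?thesis
        unfolding N_def by (intro fps_ext) (simp add: fps_sum_nth)
    qed
    finally have T: "(\<Sum>u\<in>D \<inter> {0<..1}. FT u * I c z u) = fps_const N" .
    have "(\<Sum>u\<in>D \<inter> {0<..1}. R u - L u) = - (fps_const (of_int (sgn c)) * e \<gamma> * (\<Sum>r = 1..\<bar>c\<bar>. FC ((of_int r + z) / of_int c))
      + fps_const (of_int (sgn a)) * e \<alpha> * (\<Sum>r = 1..\<bar>a\<bar>. FA ((of_int r + x) / of_int a))
      + fps_const (of_int (sgn b)) * e \<beta> * (\<Sum>r = 1..\<bar>b\<bar>. FB ((of_int r + y) / of_int b))
      + fps_const (of_int (sgn (a * b * c)) / 4) * (e \<alpha> * e \<beta> * e \<gamma>) * fps_const N)"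
      unfolding RL sum_negf sum.distrib sum_distrib_left[symmetric] C A B T ..
    moreover have "fps_const (of_int (sgn (a * b * c)) * N / 4) = fps_const (of_int (sgn (a * b * c)) / 4) * fps_const N"
      by simp
    ultimately show ?thesis
      by (simp only: e_def FC_def FA_def FB_def A_def B_def C_def times_divide_eq_right) (simp only: algebra_simps minus_minus)
  qed
  then show ?thesis using sum0 by simp
qed

subsection \<open>Generating functions of the Bernoulli functions\<close>

definition bernoulli_gf :: "real \<Rightarrow> real \<Rightarrow> real fps" where
  "bernoulli_gf \<alpha> v = Abs_fps (\<lambda>n. \<alpha> ^ n * (bernoulli_fun n v / fact n))"

text \<open>For n \<ge> 2 this is the defining recursion with its left side moved into the sum,
  where the coefficient n cancels the denominator.\<close>

lemma bernoulli_num_sum: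
  "(\<Sum>k<n. real (n choose k) * bernoulli_num k) = (if n = 1 then 1 else 0)"
proof (cases n)
  case (Suc l)
  show ?thesis
  proof (cases l)
    case (Suc j)
    have "{..<n} = insert (Suc j) {..j}" using \<open>n = Suc l\<close> Suc by auto
    then show ?thesis using \<open>n = Suc l\<close> Suc by simp
  qed (use Suc in simp)
qed simp

text \<open>The classical t / (exp t - 1), kept in product form because \<open>fps_exp 1 - 1\<close>
  has zero constant term and is not invertible as a power series.\<close>

lemma bernoulli_num_gf:
  "(fps_exp 1 - 1) * Abs_fps (\<lambda>n. bernoulli_num n / fact n) = (fps_X :: real fps)"
proof (rule fps_ext)
  fix n
  have "((fps_exp 1 - 1) * Abs_fps (\<lambda>n. bernoulli_num n / fact n)) $ n
     = (\<Sum>k\<le>n. bernoulli_num k / fact k * (fps_exp 1 - 1) $ (n - k))"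
    by (subst mult.commute) (simp add: fps_mult_nth atLeast0AtMost)
  also have "\<dots> = (\<Sum>k<n. real (n choose k) * bernoulli_num k) / fact n"
    unfolding sum_divide_distrib
    by (rule sum.mono_neutral_cong_right) (auto simp: binomial_fact)
  also have "\<dots> = fps_X $ n" by (simp add: bernoulli_num_sum)
  finally show "((fps_exp 1 - 1) * Abs_fps (\<lambda>n. bernoulli_num n / fact n)) $ n = (fps_X :: real fps) $ n" .
qed

lemma bernoulli_poly_gf:
  "(fps_exp 1 - 1) * Abs_fps (\<lambda>n. bernoulli_poly n v / fact n) = fps_X * fps_exp v"
proof -
  have "Abs_fps (\<lambda>n. bernoulli_poly n v / fact n) = Abs_fps (\<lambda>n. bernoulli_num n / fact n) * fps_exp v"
    by (rule fps_ext)
      (simp add: fps_mult_nth bernoulli_poly_def sum_divide_distrib atLeast0AtMost binomial_fact)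
  then show ?thesis by (metis bernoulli_num_gf mult.assoc)
qed

text \<open>Away from integers the two one-sided exponentials agree and
  \<open>bernoulli_poly_gf\<close> applies. At integers the sawtooth value 0 instead of -1/2 adds
  X/2 to the series, which replaces 1 by the mean of 1 and exp X.\<close>

lemma bernoulli_gf_1: "(fps_exp 1 - 1) * bernoulli_gf 1 v = fps_X * mean_exp 1 v"
proof (cases "v \<in> \<int>")
  case False
  have "bernoulli_gf 1 v = Abs_fps (\<lambda>n. bernoulli_poly n (frac v) / fact n)"
    unfolding bernoulli_gf_def using False
    by (intro fps_ext) (auto simp: bernoulli_fun_def bernoulli_poly_def sawtooth_def)
  moreover have "mean_exp 1 v = fps_const (1/2) * fps_const 2 * fps_exp (frac v)"
    using False by (simp add: mean_exp_def upper_frac_not_Ints numeral_fps_const)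
  ultimately show ?thesis by (simp add: bernoulli_poly_gf)
next
  case True
  have "bernoulli_gf 1 v = Abs_fps (\<lambda>n. bernoulli_poly n 0 / fact n) + fps_const (1/2) * fps_X"
  proof (rule fps_ext)
    fix n :: nat
    consider "n = (0::nat)" | "n = 1" | "n \<ge> 2" by linarith
    then show "bernoulli_gf 1 v $ n
        = (Abs_fps (\<lambda>n. bernoulli_poly n 0 / fact n) + fps_const (1/2) * fps_X) $ n"
      using True by cases (auto simp: bernoulli_gf_def bernoulli_fun_def bernoulli_poly_def sawtooth_def
          frac_eq_0_iff[THEN iffD2])
  qed
  moreover have "mean_exp 1 v = fps_const (1/2) * (1 + fps_exp 1)"
    using True by (simp add: mean_exp_def upper_frac_Ints)
  moreover have "1 + fps_const (1/2) * (fps_exp 1 - 1) = fps_const (1/2) * (1 + fps_exp 1 :: real fps)"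
  proof -
    have "fps_const (1/2 :: real) * 2 = 1" by (simp add: numeral_fps_const)
    then show ?thesis by algebra
  qed
  ultimately show ?thesis
    using bernoulli_poly_gf[of 0] by (simp add: algebra_simps)
qed

text \<open>Substitution of \<alpha>X for X in the case of weight 1.\<close>

lemma bernoulli_gf:
  "(fps_exp \<alpha> - 1) * bernoulli_gf \<alpha> v = fps_const \<alpha> * fps_X * mean_exp \<alpha> v"
proof -
  let ?s = "fps_const \<alpha> * fps_X :: real fps"
  have "bernoulli_gf \<alpha> v = bernoulli_gf 1 v oo ?s"
    by (rule fps_ext) (simp add: bernoulli_gf_def fps_compose_linear)
  moreover have "fps_exp \<alpha> - 1 = (fps_exp 1 - 1) oo ?s"
    by (simp add: fps_compose_sub_distrib)
  moreover have "mean_exp \<alpha> v = mean_exp 1 v oo ?s"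
    by (simp add: mean_exp_def fps_compose_mult_distrib fps_compose_add_distrib mult.commute[of \<alpha>])
  ultimately show ?thesis
    using arg_cong[OF bernoulli_gf_1[of v], of "\<lambda>f. f oo ?s"]
    by (simp add: fps_compose_mult_distrib)
qed

lemma fps_exp_minus_1_nonzero: "\<alpha> \<noteq> 0 \<Longrightarrow> fps_exp \<alpha> - 1 \<noteq> (0 :: real fps)"
  by (auto simp: fps_eq_iff intro!: exI[of _ 1])

text \<open>By \<open>mean_exp_minus\<close>, the series of - v at weight 1 and that of v at weight
  -1 have the same product with \<open>fps_exp 1 - 1\<close>, which can be cancelled.\<close>

lemma bernoulli_fun_minus: "bernoulli_fun n (- v) = (- 1) ^ n * bernoulli_fun n v"
proof -
  have "(fps_exp 1 - 1) * bernoulli_gf 1 (- v) = fps_X * fps_exp 1 * mean_exp (- 1) v"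
    by (simp add: bernoulli_gf_1 mean_exp_minus)
  also have "\<dots> = - fps_exp 1 * (fps_const (- 1) * fps_X * mean_exp (- 1) v)"
    by (simp flip: fps_const_neg)
  also have "\<dots> = - fps_exp 1 * (fps_exp (- 1) - 1) * bernoulli_gf (- 1) v"
    by (simp only: bernoulli_gf[of "- 1" v] mult.assoc[of "- fps_exp 1"])
  also have "- fps_exp 1 * (fps_exp (- 1) - 1) = fps_exp 1 - (1 :: real fps)"
    by (simp add: algebra_simps flip: fps_exp_add_mult)
  finally have "bernoulli_gf 1 (- v) = bernoulli_gf (- 1) v"
    using fps_exp_minus_1_nonzero[of 1] by simp
  from arg_cong[OF this, of "\<lambda>f. f $ n"] show ?thesis
    by (simp add: bernoulli_gf_def)
qed

lemma bernoulli_fun_add_int [simp]: "bernoulli_fun n (v + of_int k) = bernoulli_fun n v"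
  by (simp add: bernoulli_fun_def sawtooth_def Ints_add_of_int_iff)

subsection \<open>The three-term relation\<close>

lemma sum_bernoulli_gf_mult_nth:
  "(\<Sum>r = 1..\<bar>c\<bar>. bernoulli_gf \<alpha> (of_int a * (of_int r + z) / of_int c - x) *
       bernoulli_gf \<beta> (of_int b * (of_int r + z) / of_int c - y)) $ K
   = (\<Sum>i\<le>K. \<alpha> ^ i * \<beta> ^ (K - i) * (dr_sum i (K - i) a b c x y z / (fact i * fact (K - i))))"
  unfolding dr_sum_def sum_divide_distrib sum_distrib_left
  by (subst sum.swap) (simp add: fps_sum_nth fps_mult_nth bernoulli_gf_def atLeast0AtMost algebra_simps)

text \<open>Multiplying \<open>exp_reciprocity\<close> by \<alpha>X \<beta>X \<gamma>X converts the
  mean exponentials into Bernoulli series and brings out the common factor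
  \<open>e \<alpha> * e \<beta> * e \<gamma>\<close>. It is nonzero for nonzero weights and can be
  cancelled.\<close>

lemma dr_sum_reciprocity:
  fixes a b c :: int and x y z \<alpha> \<beta> \<gamma> :: real
  assumes nz: "a \<noteq> 0" "b \<noteq> 0" "c \<noteq> 0" "\<alpha> \<noteq> 0" "\<beta> \<noteq> 0" "\<gamma> \<noteq> 0"
    and rel: "of_int a * \<alpha> + of_int b * \<beta> + of_int c * \<gamma> = 0"
  defines "N \<equiv> (\<Sum>r = 1..\<bar>c\<bar>. of_bool (of_int a * (of_int r + z) / of_int c - x \<in> \<int> \<and>
                              of_int b * (of_int r + z) / of_int c - y \<in> \<int>) :: real)"
  shows "of_int (sgn c) * \<gamma> * (\<Sum>i\<le>K. \<alpha> ^ i * \<beta> ^ (K - i) * (dr_sum i (K - i) a b c x y z / (fact i * fact (K - i))))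
    + of_int (sgn a) * \<alpha> * (\<Sum>i\<le>K. \<beta> ^ i * \<gamma> ^ (K - i) * (dr_sum i (K - i) b c a y z x / (fact i * fact (K - i))))
    + of_int (sgn b) * \<beta> * (\<Sum>i\<le>K. \<alpha> ^ i * \<gamma> ^ (K - i) * (dr_sum i (K - i) a c b x z y / (fact i * fact (K - i))))
    + (if K = 2 then of_int (sgn (a * b * c)) * N / 4 * (\<alpha> * \<beta> * \<gamma>) else 0) = 0"
proof -
  define e :: "real \<Rightarrow> real fps" where "e \<delta> = fps_exp \<delta> - 1" for \<delta>
  define x' :: "real \<Rightarrow> real fps" where "x' \<delta> = fps_const \<delta> * fps_X" for \<delta>
  have gf: "x' \<delta> * mean_exp \<delta> v = e \<delta> * bernoulli_gf \<delta> v" for \<delta> v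
    by (simp add: e_def x'_def bernoulli_gf)
  have gf2: "x' \<delta> * x' \<epsilon> * (\<Sum>r\<in>I. mean_exp \<delta> (f r) * mean_exp \<epsilon> (g r)) =
    e \<delta> * e \<epsilon> * (\<Sum>r\<in>I. bernoulli_gf \<delta> (f r) * bernoulli_gf \<epsilon> (g r))"
    for \<delta> \<epsilon> and I :: "int set" and f g
    unfolding sum_distrib_left
  proof (rule sum.cong[OF refl])
    fix r
    show "x' \<delta> * x' \<epsilon> * (mean_exp \<delta> (f r) * mean_exp \<epsilon> (g r)) =
      e \<delta> * e \<epsilon> * (bernoulli_gf \<delta> (f r) * bernoulli_gf \<epsilon> (g r))"
      using gf[of \<delta> "f r"] gf[of \<epsilon> "g r"] by algebra
  qed
  define MC where "MC = (\<Sum>r = 1..\<bar>c\<bar>.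
        mean_exp \<alpha> (of_int a * (of_int r + z) / of_int c - x) *
        mean_exp \<beta> (of_int b * (of_int r + z) / of_int c - y))"
  define MA where "MA = (\<Sum>r = 1..\<bar>a\<bar>.
        mean_exp \<beta> (of_int b * (of_int r + x) / of_int a - y) *
        mean_exp \<gamma> (of_int c * (of_int r + x) / of_int a - z))"
  define MB where "MB = (\<Sum>r = 1..\<bar>b\<bar>.
        mean_exp \<alpha> (of_int a * (of_int r + y) / of_int b - x) *
        mean_exp \<gamma> (of_int c * (of_int r + y) / of_int b - z))"
  define SC where "SC = (\<Sum>r = 1..\<bar>c\<bar>.
        bernoulli_gf \<alpha> (of_int a * (of_int r + z) / of_int c - x) *
        bernoulli_gf \<beta> (of_int b * (of_int r + z) / of_int c - y))"
  define SA where "SA = (\<Sum>r = 1..\<bar>a\<bar>.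
        bernoulli_gf \<beta> (of_int b * (of_int r + x) / of_int a - y) *
        bernoulli_gf \<gamma> (of_int c * (of_int r + x) / of_int a - z))"
  define SB where "SB = (\<Sum>r = 1..\<bar>b\<bar>.
        bernoulli_gf \<alpha> (of_int a * (of_int r + y) / of_int b - x) *
        bernoulli_gf \<gamma> (of_int c * (of_int r + y) / of_int b - z))"
  define sc sa sb sN where "sc = fps_const (real_of_int (sgn c))" and "sa = fps_const (real_of_int (sgn a))"
    and "sb = fps_const (real_of_int (sgn b))" and "sN = fps_const (of_int (sgn (a * b * c)) * N / 4)"
  have "sc * e \<gamma> * MC + sa * e \<alpha> * MA + sb * e \<beta> * MB + sN * (e \<alpha> * e \<beta> * e \<gamma>) = 0"
    using exp_reciprocity[OF nz(1-3) rel, of z x y]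
    unfolding MC_def MA_def MB_def e_def N_def sc_def sa_def sb_def sN_def .
  moreover have "x' \<alpha> * x' \<beta> * MC = e \<alpha> * e \<beta> * SC" "x' \<beta> * x' \<gamma> * MA = e \<beta> * e \<gamma> * SA"
    "x' \<alpha> * x' \<gamma> * MB = e \<alpha> * e \<gamma> * SB"
    unfolding MC_def SC_def MA_def SA_def MB_def SB_def by (rule gf2)+
  ultimately have "e \<alpha> * e \<beta> * e \<gamma> * (sc * x' \<gamma> * SC + sa * x' \<alpha> * SA + sb * x' \<beta> * SB
      + sN * (x' \<alpha> * x' \<beta> * x' \<gamma>)) = 0"
    by algebra
  moreover have "e \<alpha> * e \<beta> * e \<gamma> \<noteq> 0"
    using nz(4-6) fps_exp_minus_1_nonzero by (simp add: e_def)
  ultimately have "sc * x' \<gamma> * SC + sa * x' \<alpha> * SA + sb * x' \<beta> * SB + sN * (x' \<alpha> * x' \<beta> * x' \<gamma>) = 0"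
    by (simp only: mult_eq_0_iff) simp
  \<comment> \<open>One factor X is common to all terms. The triple term carries X^3, so after
    division it contributes X^2 and is seen only for K = 2.\<close>
  moreover have "sc * x' \<gamma> * SC + sa * x' \<alpha> * SA + sb * x' \<beta> * SB + sN * (x' \<alpha> * x' \<beta> * x' \<gamma>) =
      fps_X * (fps_const (of_int (sgn c) * \<gamma>) * SC + fps_const (of_int (sgn a) * \<alpha>) * SA
        + fps_const (of_int (sgn b) * \<beta>) * SB
        + fps_const (of_int (sgn (a * b * c)) * N / 4 * (\<alpha> * \<beta> * \<gamma>)) * fps_X ^ 2)"
    unfolding fps_const_mult[symmetric]
    by (simp only: x'_def sc_def sa_def sb_def sN_def power2_eq_square) (simp only: algebra_simps)
  ultimately have "fps_const (of_int (sgn c) * \<gamma>) * SC + fps_const (of_int (sgn a) * \<alpha>) * SA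
        + fps_const (of_int (sgn b) * \<beta>) * SB
        + fps_const (of_int (sgn (a * b * c)) * N / 4 * (\<alpha> * \<beta> * \<gamma>)) * fps_X ^ 2 = 0"
    by (metis fps_X_neq_zero mult_eq_0_iff)
  from arg_cong[OF this, of "\<lambda>f. f $ K"] show ?thesis
    unfolding SC_def SA_def SB_def fps_add_nth fps_mult_left_const_nth sum_bernoulli_gf_mult_nth
    by (cases "K = 2") (simp_all add: fps_X_power_nth)
qed

text \<open>The relation with weights (- q, 1, 0) on the moduli (1, q, 1) is the multiplication theorem.\<close>

lemma bernoulli_fun_multiplication:
  assumes "q \<noteq> 0"
  shows "of_int (sgn q) * of_int q ^ K * (\<Sum>r = 1..\<bar>q\<bar>. bernoulli_fun K ((of_int r + y) / of_int q))
    = of_int q * bernoulli_fun K y"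
proof -
  let ?q = "real_of_int q"
  define e where "e \<delta> = fps_exp \<delta> - 1" for \<delta> :: real
  define M where "M = (\<Sum>r = 1..\<bar>q\<bar>. mean_exp (- ?q) ((of_int r + y) / of_int q))"
  define S where "S = (\<Sum>r = 1..\<bar>q\<bar>. bernoulli_gf (- ?q) ((of_int r + y) / of_int q))"
  define s where "s = fps_const (real_of_int (sgn q))"
  \<comment> \<open>Weight 0 makes the third exponential difference vanish, and with it one sum and
    the triple term; the remaining sum of modulus 1 consists of its term r = 1.\<close>
  have "e (- ?q) * mean_exp 1 (?q - y) + s * e 1 * M = 0"
    using exp_reciprocity[of 1 q 1 "- ?q" 1 0 0 0 y] assms by (simp add: M_def e_def s_def)
  moreover have "fps_const (- ?q) * fps_X * M = e (- ?q) * S"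
    unfolding M_def S_def sum_distrib_left by (simp add: bernoulli_gf e_def)
  moreover have "fps_X * mean_exp 1 (?q - y) = e 1 * bernoulli_gf 1 (?q - y)"
    by (simp add: e_def bernoulli_gf_1)
  ultimately have "e (- ?q) * e 1 * (fps_const (- ?q) * bernoulli_gf 1 (?q - y) + s * S) = 0"
    by algebra
  moreover have "e (- ?q) * e 1 \<noteq> 0"
    unfolding e_def using assms by (simp only: mult_eq_0_iff fps_exp_minus_1_nonzero) simp
  ultimately have "fps_const (- ?q) * bernoulli_gf 1 (?q - y) + s * S = 0"
    by (simp only: mult_eq_0_iff) simp
  then have "(fps_const (- ?q) * bernoulli_gf 1 (?q - y) + s * S) $ K = 0" by simp
  then have "- ?q * bernoulli_fun K (- y) + of_int (sgn q) * (- ?q) ^ K *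
      (\<Sum>r = 1..\<bar>q\<bar>. bernoulli_fun K ((of_int r + y) / of_int q)) = 0"
    using bernoulli_fun_add_int[of K "- y" q]
    by (simp add: s_def S_def bernoulli_gf_def fps_sum_nth sum_distrib_left sum_divide_distrib field_simps)
  \<comment> \<open>Reflection turns - y into y with the sign (-1)^K, which matches the sign of
    (-q)^K.\<close>
  then show ?thesis
    by (cases "even K") (simp_all add: bernoulli_fun_minus)
qed

section \<open>Complete residue systems and the gcd evaluation\<close>

lemma sum_int_periods:
  fixes f :: "int \<Rightarrow> 'a::comm_semiring_1"
  assumes "k > 0" and "\<And>r. f (r + k) = f r"
  shows "sum f {0..<int g * k} = of_nat g * sum f {0..<k}"
proof (induction g)
  case (Suc g)
  have "{0..<int (Suc g) * k} = {0..<int g * k} \<union> {int g * k..<int g * k + k}"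
    using assms(1) by (auto simp: algebra_simps ivl_disj_un)
  then have "sum f {0..<int (Suc g) * k} = sum f {0..<int g * k} + sum f {int g * k..<int g * k + k}"
    by (simp add: sum.union_disjoint)
  also have "sum f {int g * k..<int g * k + k} = sum f {0..<k}"
    using sum_periodic_int[of k f "int g * k" 0] assms by simp
  finally show ?case using Suc by (simp add: algebra_simps)
qed simp

lemma periodic_int_mod:
  fixes f :: "int \<Rightarrow> 'a"
  assumes "\<And>r. f (r + k) = f r"
  shows "f (r mod k) = f r"
proof -
  have "f (r + j * k) = f r" for r j
  proof (induction j rule: int_induct[where k = 0])
    case (step1 i)
    then show ?case using assms[of "r + i * k"] by (simp add: algebra_simps)
  next
    case (step2 i)
    then show ?case using assms[of "r + (i - 1) * k"] by (simp add: algebra_simps)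
  qed simp
  from this[of "r mod k" "r div k"] show ?thesis by simp
qed

text \<open>Multiplication by \<open>b\<close> permutes the residues modulo
  \<open>k\<close>.\<close>

lemma sum_periodic_coprime:
  fixes f :: "int \<Rightarrow> 'a::comm_monoid_add"
  assumes "k > 0" and "coprime b k" and per: "\<And>r. f (r + k) = f r"
  shows "(\<Sum>r\<in>{0..<k}. f (b * r)) = sum f {0..<k}"
proof -
  have inj: "inj_on (\<lambda>r. (b * r) mod k) {0..<k}"
  proof (rule inj_onI)
    fix r s assume rs: "r \<in> {0..<k}" "s \<in> {0..<k}" and "(b * r) mod k = (b * s) mod k"
    then have "k dvd b * (r - s)" by (simp add: mod_eq_dvd_iff right_diff_distrib)
    then have "k dvd r - s" using assms(2) by (simp add: coprime_commute coprime_dvd_mult_right_iff)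
    then have "r mod k = s mod k" by (simp add: mod_eq_dvd_iff)
    then show "r = s" using rs by simp
  qed
  then have img: "(\<lambda>r. (b * r) mod k) ` {0..<k} = {0..<k}"
    using assms(1) by (intro endo_inj_surj) auto
  have "(\<Sum>r\<in>{0..<k}. f (b * r)) = (\<Sum>r\<in>{0..<k}. f ((b * r) mod k))"
    using periodic_int_mod[of f, OF per] by simp
  also have "\<dots> = sum f ((\<lambda>r. (b * r) mod k) ` {0..<k})"
    by (simp add: sum.reindex[OF inj])
  finally show ?thesis by (simp only: img)
qed

text \<open>After division by g = gcd a b the summand depends only on b' r modulo a'. The range
  consists of g periods of length \<bar>a'\<bar>; in each, the coprime factor b' permutes the
  residues, and the multiplication theorem for modulus a' sums what is left.\<close>

lemma sum_bernoulli_fun_gcd: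
  assumes "a \<noteq> 0"
  shows "of_int (sgn a) * of_int a ^ K * (\<Sum>r = 1..\<bar>a\<bar>. bernoulli_fun K (of_int b * (of_int r + x) / of_int a - y))
    = of_int a * of_int (gcd a b) ^ K * bernoulli_fun K ((of_int b * x - of_int a * y) / of_int (gcd a b))"
proof -
  define g where "g = gcd a b"
  have g: "g > 0" using assms by (simp add: g_def)
  obtain a' b' where ab: "a = g * a'" "b = g * b'" "coprime a' b'"
    using gcd_coprime_exists[of a b] assms unfolding g_def by (metis gcd_eq_0_iff mult.commute)
  have a': "a' \<noteq> 0" using assms ab by auto
  define Y where "Y = (of_int b * x - of_int a * y) / of_int g"
  \<comment> \<open>With this \<open>Y\<close> the argument b (r + x) / a - y equals (b' r + Y) /
    a'.\<close>
  define h where "h r = bernoulli_fun K ((of_int r + Y) / of_int a')" for r :: int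
  have h_per: "h (r + a') = h r" for r
    using bernoulli_fun_add_int[of K "(of_int r + Y) / of_int a'" 1] a' by (simp add: h_def field_simps)
  have h_abs: "h (r + \<bar>a'\<bar>) = h r" for r
    using h_per[of r] h_per[of "r - a'"] by (cases "a' > 0") auto
  have hb_abs: "h (b' * (r + \<bar>a'\<bar>)) = h (b' * r)" for r
    using periodic_int_mod[of h "\<bar>a'\<bar>", OF h_abs, of "b' * (r + \<bar>a'\<bar>)"]
      periodic_int_mod[of h "\<bar>a'\<bar>", OF h_abs, of "b' * r"]
    by (simp add: distrib_left)
  have "(\<Sum>r = 1..\<bar>a\<bar>. bernoulli_fun K (of_int b * (of_int r + x) / of_int a - y)) = (\<Sum>r = 1..\<bar>a\<bar>. h (b' * r))"
    using a' g unfolding h_def Y_def ab by (intro sum.cong arg_cong[of _ _ "bernoulli_fun K"]) (auto simp: field_simps)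
  also have "\<dots> = (\<Sum>r\<in>{1..<1 + \<bar>a\<bar>}. h (b' * r))" by (rule sum.cong) auto
  also have "\<dots> = (\<Sum>r\<in>{0..<0 + \<bar>a\<bar>}. h (b' * r))"
  proof (rule sum_periodic_int)
    fix r
    have "h (b' * (r + g * \<bar>a'\<bar>)) = h (b' * r)"
      using periodic_int_mod[of "\<lambda>r. h (b' * r)" "\<bar>a'\<bar>", OF hb_abs, of "r + g * \<bar>a'\<bar>"]
        periodic_int_mod[of "\<lambda>r. h (b' * r)" "\<bar>a'\<bar>", OF hb_abs, of r] by simp
    then show "h (b' * (r + \<bar>a\<bar>)) = h (b' * r)" using g by (simp add: ab abs_mult)
  qed (use assms in simp)
  also have "{0..<0 + \<bar>a\<bar>} = {0..<int (nat g) * \<bar>a'\<bar>}" using g by (simp add: ab abs_mult)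
  also have "(\<Sum>r\<in>\<dots>. h (b' * r)) = of_nat (nat g) * (\<Sum>r\<in>{0..<\<bar>a'\<bar>}. h (b' * r))"
    by (rule sum_int_periods) (use a' hb_abs in auto)
  also have "(\<Sum>r\<in>{0..<\<bar>a'\<bar>}. h (b' * r)) = sum h {0..<\<bar>a'\<bar>}"
    by (rule sum_periodic_coprime) (use a' h_abs ab in \<open>auto simp: coprime_commute\<close>)
  also have "\<dots> = sum h {1..<1 + \<bar>a'\<bar>}"
    using sum_periodic_int[of "\<bar>a'\<bar>" h 0 1] h_abs a' by simp
  also have "{1..<1 + \<bar>a'\<bar>} = {1..\<bar>a'\<bar>}" by auto
  finally have "(\<Sum>r = 1..\<bar>a\<bar>. bernoulli_fun K (of_int b * (of_int r + x) / of_int a - y))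
      = of_int g * sum h {1..\<bar>a'\<bar>}" using g by simp
  moreover have "of_int (sgn a') * of_int a' ^ K * sum h {1..\<bar>a'\<bar>} = of_int a' * bernoulli_fun K Y"
    unfolding h_def by (rule bernoulli_fun_multiplication[OF a'])
  moreover have "sgn a = sgn a'" using g by (simp add: ab sgn_mult)
  ultimately have "of_int (sgn a) * of_int a ^ K * (\<Sum>r = 1..\<bar>a\<bar>. bernoulli_fun K (of_int b * (of_int r + x) / of_int a - y))
      = of_int g ^ K * of_int g * (of_int a' * bernoulli_fun K Y)"
    by (simp add: ab(1) power_mult_distrib)
  also have "\<dots> = of_int a * of_int g ^ K * bernoulli_fun K Y"
    by (simp add: ab(1))
  finally show ?thesis unfolding Y_def g_def .
qed

text \<open>The index \<open>t\<close> determines \<open>r\<close> and \<open>s\<close>, which exist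
  exactly when two numbers are integers. Since sgn c (t + z) / c = (t + z) / \<bar>c\<bar>, the
  bounds select a window of \<bar>c\<bar> consecutive \<open>t\<close>, which periodicity shifts to
  start at 1.\<close>

lemma triple_count_eq:
  assumes "a \<noteq> 0" "b \<noteq> 0" "c \<noteq> 0"
  shows "real (triple_count a b c x y z) =
    (\<Sum>r = 1..\<bar>c\<bar>. of_bool (of_int a * (of_int r + z) / of_int c - x \<in> \<int> \<and>
                          of_int b * (of_int r + z) / of_int c - y \<in> \<int>))"
proof -
  let ?A = "\<lambda>t::int. of_int a * (of_int t + z) / of_int c - x"
  let ?B = "\<lambda>t::int. of_int b * (of_int t + z) / of_int c - y"
  let ?f = "\<lambda>t::int. (\<lfloor>?A t\<rfloor>, \<lfloor>?B t\<rfloor>, t)"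
  define P where "P t \<longleftrightarrow> ?A t \<in> \<int> \<and> ?B t \<in> \<int>" for t
  define J where "J = {t::int. 0 \<le> of_int t + z \<and> of_int t + z < of_int \<bar>c\<bar>}"
  have sgn_div: "of_int (sgn c) * ((of_int t + z) / of_int c) = (of_int t + z) / of_int \<bar>c\<bar>" for t
    using assms(3) by (cases "c > 0") (auto simp: sgn_if minus_divide_left)
  have ceq: "of_int (sgn c) * u = of_int (sgn c) * v \<longleftrightarrow> u = v" for u v :: real
    using assms(3) by (simp add: sgn_if)
  have J: "t \<in> J \<longleftrightarrow> 0 \<le> (of_int t + z) / of_int \<bar>c\<bar> \<and> (of_int t + z) / of_int \<bar>c\<bar> < 1" for t
    using assms(3) by (auto simp: J_def field_simps)
  have eqA: "(of_int r + x) / of_int a = (of_int t + z) / of_int c \<longleftrightarrow> ?A t = of_int r" for r t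
    using assms by (auto simp: field_simps)
  have eqB: "(of_int s + y) / of_int b = (of_int t + z) / of_int c \<longleftrightarrow> ?B t = of_int s" for s t
    using assms by (auto simp: field_simps)
  have "triple_count a b c x y z = card {(r, s, t). t \<in> J \<and> ?A t = of_int r \<and> ?B t = of_int s}"
    unfolding triple_count_def ceq eqA[symmetric] eqB[symmetric] J sgn_div[symmetric]
    by (rule arg_cong[of _ _ card]) (auto simp del: times_divide_eq_right)
  also have "{(r, s, t). t \<in> J \<and> ?A t = of_int r \<and> ?B t = of_int s} = ?f ` {t \<in> J. P t}"
    by (auto simp: P_def image_iff elim!: Ints_cases)
  also have "card \<dots> = card {t \<in> J. P t}"
    by (intro card_image) (auto simp: inj_on_def)
  finally have "real (triple_count a b c x y z) = real (card {t \<in> J. P t})" by simp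
  also have "\<dots> = (\<Sum>t\<in>J. of_bool (P t))"
    unfolding J_def int_interval_eq by (simp add: Int_def flip: of_nat_sum)
  also have "\<dots> = (\<Sum>t\<in>{1..<1 + \<bar>c\<bar>}. of_bool (P t))"
    unfolding J_def int_interval_eq
  proof (rule sum_periodic_int)
    fix t
    have "P (t + c) \<longleftrightarrow> P t" for t
    proof -
      have "?A (t + c) = ?A t + of_int a" "?B (t + c) = ?B t + of_int b"
        using assms(3) by (simp_all add: field_simps)
      then show ?thesis unfolding P_def by (simp only: Ints_add_of_int_iff)
    qed
    from this[of t] this[of "t - c"]
    show "of_bool (P (t + \<bar>c\<bar>)) = (of_bool (P t) :: real)" by (cases "c > 0") auto
  qed (use assms in simp)
  also have "{1..<1 + \<bar>c\<bar>} = {1..\<bar>c\<bar>}" by auto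
  finally show ?thesis by (simp add: P_def)
qed

subsection \<open>Comparison of coefficients\<close>

text \<open>The factorial of m + n - i is m + n - i times the numerator of the binomial coefficient.
  This converts the coefficients of powers of \<gamma> into the weights of the theorem.\<close>

lemma factorial_weight:
  fixes D :: real
  assumes "m \<ge> 1" "i \<le> n"
  shows "fact m * fact n * (D / (fact i * fact (m + n - i)) * real ((m + n - 1 - i) choose (m - 1)))
    = real m * real (n choose i) * D / real (m + n - i)"
proof -
  define k where "k = m + n - 1 - i"
  have k: "m + n - i = Suc k" using assms by (simp add: k_def)
  have m: "fact m = real m * fact (m - 1)" using assms by (simp add: fact_reduce)
  have "k - (m - 1) = n - i" using assms by (simp add: k_def)
  then have "real (k choose (m - 1)) = fact k / (fact (m - 1) * fact (n - i))"
    using assms by (subst binomial_fact) (simp_all add: k_def)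
  moreover have "real (n choose i) = fact n / (fact i * fact (n - i))"
    using assms by (simp add: binomial_fact)
  ultimately show ?thesis
    unfolding k_def[symmetric] k m fact_Suc by (simp del: of_nat_Suc add: mult_ac)
qed

theorem theorem4p1:
  fixes m n :: nat and a b c :: int and x y z :: real
  assumes "m \<ge> 1" and "n \<ge> 1" and "a \<noteq> 0" and "b \<noteq> 0" and "c \<noteq> 0"
  shows "dr_sum m n a b c x y z =
      real n * of_int b ^ (n - 1) * of_int (sgn (b * c)) *
        (\<Sum>j = 0..m. real (m choose j) *
           ((-1) ^ (m + n - j) * of_int a ^ (m - j) /
            (of_int c ^ (m + n - j - 1) * real (m + n - j))) *
           dr_sum j (m + n - j) a c b x z y)
    + real m * of_int a ^ (m - 1) * of_int (sgn (a * c)) *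
        (\<Sum>j = 0..n. real (n choose j) *
           ((-1) ^ (m + n - j) * of_int b ^ (n - j) /
            (of_int c ^ (m + n - j - 1) * real (m + n - j))) *
           dr_sum j (m + n - j) b c a y z x)
    + (-1) ^ (n - 1) * fact m * fact n * of_int c * of_int (gcd a b) ^ (m + n) *
        of_int (sgn c) *
        bernoulli_fun (m + n) ((of_int a * y - of_int b * x) / of_int (gcd a b)) /
        (of_int a ^ n * of_int b ^ m * fact (m + n))
    - kronecker 1 m * kronecker 1 n * of_int (sgn (a * b)) *
        (real (triple_count a b c x y z) / 4)"
proof -
  define K where "K = m + n"
  define a' b' c' where "a' = real_of_int a" and "b' = real_of_int b" and "c' = real_of_int c"
  have nz: "a' \<noteq> 0" "b' \<noteq> 0" "c' \<noteq> 0" using assms by (simp_all add: a'_def b'_def c'_def)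
  define sa sb sc where "sa = real_of_int (sgn a)" and "sb = real_of_int (sgn b)" and "sc = real_of_int (sgn c)"
  define C where "C i = dr_sum i (K - i) a b c x y z / (fact i * fact (K - i))" for i
  define A where "A i = dr_sum i (K - i) b c a y z x / (fact i * fact (K - i))" for i
  define B where "B i = dr_sum i (K - i) a c b x z y / (fact i * fact (K - i))" for i
  define N where "N = real (triple_count a b c x y z)"
  \<comment> \<open>Only K = 2, that is m = n = 1, sees the triple coincidences.\<close>
  define \<tau> where "\<tau> = (if K = 2 then sa * sb * sc * N / 4 else 0)"
  define q where "q = of_int (gcd a b) ^ K * bernoulli_fun K ((of_int a * y - of_int b * x) / of_int (gcd a b)) / fact K"

  \<comment> \<open>Boundary terms of the three-term relation\<close>
  have K: "K \<ge> 2" using assms by (simp add: K_def)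
  \<comment> \<open>For i = K the second index is 0, so the sum involves one Bernoulli function and
    \<open>sum_bernoulli_fun_gcd\<close> evaluates it. Its argument is the negative of the one in
    \<open>q\<close>, whence (-1)^K.\<close>
  have A_K: "sa * A K = (- 1) ^ K * q / a' ^ (K - 1)"
  proof -
    have "bernoulli_fun K ((of_int b * x - of_int a * y) / of_int (gcd a b))
        = (- 1) ^ K * bernoulli_fun K ((of_int a * y - of_int b * x) / of_int (gcd a b))"
      by (subst bernoulli_fun_minus[symmetric]) (simp add: minus_divide_left)
    then have "sa * a' ^ K * (A K * fact K) = a' * ((- 1) ^ K * q * fact K)"
      using sum_bernoulli_fun_gcd[OF assms(3), of K b x y]
      by (simp add: A_def dr_sum_def bernoulli_fun_def[of 0] sa_def a'_def q_def mult_ac)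
    then have "a' * (a' ^ (K - 1) * (sa * A K)) = a' * ((- 1) ^ K * q)"
      using K by (simp add: power_eq_if mult_ac)
    then show ?thesis using nz by (simp add: field_simps)
  qed
  \<comment> \<open>Here \<open>a\<close> and \<open>b\<close> are exchanged, so the argument is the
    one in \<open>q\<close> and no sign arises.\<close>
  have B_K: "sb * B K = q / b' ^ (K - 1)"
  proof -
    have "sb * b' ^ K * (B K * fact K) = b' * (q * fact K)"
      using sum_bernoulli_fun_gcd[OF assms(4), of K a y x]
      by (simp add: B_def dr_sum_def bernoulli_fun_def[of 0] sb_def b'_def q_def mult_ac gcd.commute)
    then have "b' * (b' ^ (K - 1) * (sb * B K)) = b' * q"
      using K by (simp add: power_eq_if mult_ac)
    then show ?thesis using nz by (simp add: field_simps)
  qed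

  \<comment> \<open>The relation as a polynomial identity\<close>
  define G where "G = [: - b' / c', - a' / c' :]"
  \<comment> \<open>The three-term relation of degree K at \<beta> = 1 and \<gamma> = G(\<alpha>), divided by \<gamma>. The terms i = K
    carry no factor \<gamma>, but by \<open>A_K\<close> and \<open>B_K\<close> together they form a difference of (K - 1)-st powers
    divisible by \<gamma>: this gives the gcd term.\<close>
  define W where "W = Polynomial.smult sc (\<Sum>i\<le>K. monom (C i) i)
    + Polynomial.smult sa (\<Sum>i<K. Polynomial.smult (A i) (monom 1 1 * G ^ (K - 1 - i)))
    + Polynomial.smult sb (\<Sum>i<K. Polynomial.smult (B i) (monom 1 i * G ^ (K - 1 - i)))
    + monom \<tau> 1
    - Polynomial.smult (c' * q / (a' * b')) (\<Sum>i<K - 1. monom ((- 1 / a') ^ (K - 1 - Suc i) * (1 / b') ^ i) (Suc i))"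
  have W_root: "poly W \<alpha> = 0" if "\<alpha> \<noteq> 0" "\<alpha> \<noteq> - b' / a'" for \<alpha>
  proof -
    define \<gamma> where "\<gamma> = poly G \<alpha>"
    have \<gamma>: "\<gamma> = - (a' * \<alpha> + b') / c'" using nz by (simp add: \<gamma>_def G_def field_simps)
    have "\<gamma> \<noteq> 0" using that nz by (auto simp: \<gamma> field_simps add_eq_0_iff)
    \<comment> \<open>Setting \<beta> = 1 loses nothing: after division by \<gamma> the relation is
      homogeneous of degree K in the weights, so \<alpha>^m stands for \<alpha>^m \<beta>^n.\<close>
    have rel: "of_int a * \<alpha> + of_int b * 1 + of_int c * \<gamma> = 0"
      using nz by (simp add: \<gamma> a'_def b'_def c'_def)
    have recip: "sc * \<gamma> * (\<Sum>i\<le>K. \<alpha> ^ i * C i) + sa * \<alpha> * (\<Sum>i\<le>K. \<gamma> ^ (K - i) * A i)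
        + sb * (\<Sum>i\<le>K. \<alpha> ^ i * \<gamma> ^ (K - i) * B i) + \<tau> * (\<alpha> * \<gamma>) = 0"
      using dr_sum_reciprocity[OF assms(3-5) that(1) one_neq_zero \<open>\<gamma> \<noteq> 0\<close> rel, of K x y z]
      unfolding triple_count_eq[OF assms(3-5), symmetric]
      by (simp add: C_def A_def B_def sa_def sb_def sc_def \<tau>_def N_def sgn_mult split: if_splits)
    have split: "(\<Sum>i\<le>K. f i * \<gamma> ^ (K - i) * g i) = f K * g K + \<gamma> * (\<Sum>i<K. f i * \<gamma> ^ (K - 1 - i) * g i)" for f g
    proof -
      have "(\<Sum>i<K. f i * \<gamma> ^ (K - i) * g i) = \<gamma> * (\<Sum>i<K. f i * \<gamma> ^ (K - 1 - i) * g i)"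
        unfolding sum_distrib_left
      proof (rule sum.cong[OF refl])
        fix i assume "i \<in> {..<K}"
        then have "K - i = Suc (K - 1 - i)" by auto
        then show "f i * \<gamma> ^ (K - i) * g i = \<gamma> * (f i * \<gamma> ^ (K - 1 - i) * g i)" by simp
      qed
      then show ?thesis by (simp flip: lessThan_Suc_atMost)
    qed
    \<comment> \<open>The cofactor of u - v in u^(K-1) - v^(K-1), at u = \<alpha>/b' and v =
      -1/a'.\<close>
    define Z where "Z = (\<Sum>i<K - 1. (- 1 / a') ^ (K - 1 - Suc i) * (\<alpha> / b') ^ i)"
    have "sa * \<alpha> * A K + sb * (\<alpha> ^ K * B K) = q * \<alpha> * ((\<alpha> / b') ^ (K - 1) - (- 1 / a') ^ (K - 1))"
    proof -
      have "sa * \<alpha> * A K + sb * (\<alpha> ^ K * B K) = \<alpha> * (sa * A K) + \<alpha> ^ K * (sb * B K)"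
        by (simp add: algebra_simps)
      also have "\<dots> = q * \<alpha> * ((- 1) ^ K / a' ^ (K - 1) + \<alpha> ^ (K - 1) / b' ^ (K - 1))"
        using K by (simp add: A_K B_K distrib_left power_eq_if[of \<alpha> K] mult_ac)
      also have "(- 1) ^ K / a' ^ (K - 1) = - ((- 1 / a') ^ (K - 1))"
        using K by (simp add: power_minus[of "1 / a'"] power_divide power_eq_if[of _ K])
      finally show ?thesis by (simp add: power_divide)
    qed
    also have "\<dots> = q * \<alpha> * ((\<alpha> / b' - (- 1 / a')) * Z)"
      unfolding Z_def power_diff_sumr2 ..
    \<comment> \<open>The factor \<gamma> of the boundary terms appears here, since a'\<alpha> + b'
      = -c'\<gamma>.\<close>
    also have "\<alpha> / b' - (- 1 / a') = - (c' / (a' * b')) * \<gamma>"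
      using nz by (simp add: \<gamma> field_simps)
    finally have ends: "sa * \<alpha> * A K + sb * (\<alpha> ^ K * B K) = - \<gamma> * (c' * q / (a' * b') * (\<alpha> * Z))"
      by (simp add: algebra_simps)
    have "poly W \<alpha> = sc * (\<Sum>i\<le>K. \<alpha> ^ i * C i) + sa * \<alpha> * (\<Sum>i<K. \<gamma> ^ (K - 1 - i) * A i)
      + sb * (\<Sum>i<K. \<alpha> ^ i * \<gamma> ^ (K - 1 - i) * B i) + \<tau> * \<alpha> - c' * q / (a' * b') * (\<alpha> * Z)"
      unfolding W_def Z_def
      by (simp add: poly_sum poly_monom \<gamma>_def sum_distrib_left power_divide mult_ac)
    moreover have "\<gamma> * (sc * X + sa * \<alpha> * Y + sb * V + \<tau> * \<alpha> - E)
        = sc * \<gamma> * X + sa * \<alpha> * (P + \<gamma> * Y) + sb * (Q + \<gamma> * V) + \<tau> * (\<alpha> * \<gamma>)"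
      if "sa * \<alpha> * P + sb * Q = - \<gamma> * E" for X Y V P Q E
      using that by algebra
    ultimately have "\<gamma> * poly W \<alpha> = sc * \<gamma> * (\<Sum>i\<le>K. \<alpha> ^ i * C i) + sa * \<alpha> * (\<Sum>i\<le>K. \<gamma> ^ (K - i) * A i)
        + sb * (\<Sum>i\<le>K. \<alpha> ^ i * \<gamma> ^ (K - i) * B i) + \<tau> * (\<alpha> * \<gamma>)"
      using split[of "\<lambda>_. 1" A] split[of "\<lambda>i. \<alpha> ^ i" B] ends by (simp only: mult_1)
    with recip \<open>\<gamma> \<noteq> 0\<close> show ?thesis by simp
  qed
  have "W = 0"
  proof (rule ccontr)
    assume "W \<noteq> 0"
    then have "finite {\<alpha>. poly W \<alpha> = 0}" by (rule poly_roots_finite)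
    moreover have "UNIV - {0, - b' / a'} \<subseteq> {\<alpha>. poly W \<alpha> = 0}" using W_root by auto
    ultimately have "finite (UNIV - {0, - b' / a'})" by (rule finite_subset[rotated])
    then show False by (simp add: infinite_UNIV_char_0)
  qed
  then have "coeff W m = 0" by simp

  \<comment> \<open>Extraction of the coefficient of \<alpha>^m\<close>
  have coeff_G: "coeff (G ^ k) i = real (k choose i) * (- a' / c') ^ i * (- b' / c') ^ (k - i)" for k i
  proof (cases "i \<le> k")
    case False
    have "degree (G ^ k) \<le> k" using degree_power_le[of G k] by (simp add: G_def split: if_splits)
    then show ?thesis using False by (simp add: coeff_eq_0 binomial_eq_0)
  qed (simp add: G_def coeff_linear_poly_power)
  \<comment> \<open>The extra factor \<alpha> lowers the index to m - 1; for i > n the upper entry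
    of the binomial coefficient is too small and the term vanishes.\<close>
  have sumA: "(\<Sum>i<K. A i * coeff (G ^ (K - 1 - i)) (m - 1)) =
      (\<Sum>i\<le>n. A i * (real ((K - 1 - i) choose (m - 1)) * (- a' / c') ^ (m - 1) * (- b' / c') ^ (n - i)))"
    unfolding coeff_G
    using assms by (intro sum.mono_neutral_cong_right) (auto simp: K_def binomial_eq_0 algebra_simps)
  \<comment> \<open>Here the factor is \<alpha>^i, so terms with i > m drop out. Symmetry of the
    binomial coefficients gives the shape of \<open>factorial_weight\<close> with \<open>m\<close>
    and \<open>n\<close> exchanged.\<close>
  have sumB: "(\<Sum>i<K. B i * (if i \<le> m then coeff (G ^ (K - 1 - i)) (m - i) else 0)) =
      (\<Sum>i\<le>m. B i * (real ((K - 1 - i) choose (n - 1)) * (- a' / c') ^ (m - i) * (- b' / c') ^ (n - 1)))"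
  proof (rule sum.mono_neutral_cong_right)
    fix i assume i: "i \<in> {..m}"
    then have "(K - 1 - i) choose (m - i) = (K - 1 - i) choose (n - 1)" "K - 1 - i - (m - i) = n - 1"
      using assms binomial_symmetric[of "m - i" "K - 1 - i"] by (simp_all add: K_def)
    then show "B i * (if i \<le> m then coeff (G ^ (K - 1 - i)) (m - i) else 0) =
      B i * (real ((K - 1 - i) choose (n - 1)) * (- a' / c') ^ (m - i) * (- b' / c') ^ (n - 1))"
      using i unfolding coeff_G by simp
  qed (use assms in \<open>auto simp: K_def\<close>)
  \<comment> \<open>Only i = m - 1 produces \<alpha>^m.\<close>
  have sumQ: "(\<Sum>i<K - 1. if Suc i = m then (- 1 / a') ^ (K - 1 - Suc i) * (1 / b') ^ i else 0)
     = (- 1 / a') ^ (n - 1) * (1 / b') ^ (m - 1)"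
  proof -
    have "(\<Sum>i<K - 1. if Suc i = m then (- 1 / a') ^ (K - 1 - Suc i) * (1 / b') ^ i else 0)
      = (\<Sum>i\<in>{m - 1}. (- 1 / a') ^ (K - 1 - Suc i) * (1 / b') ^ i)"
      using assms by (intro sum.mono_neutral_cong_right) (auto simp: K_def)
    then show ?thesis using assms by (simp add: K_def)
  qed
  have "coeff W m = sc * C m + sa * (\<Sum>i<K. A i * coeff (G ^ (K - 1 - i)) (m - 1))
    + sb * (\<Sum>i<K. B i * (if i \<le> m then coeff (G ^ (K - 1 - i)) (m - i) else 0))
    + (if m = 1 then \<tau> else 0) - c' * q / (a' * b') * ((- 1 / a') ^ (n - 1) * (1 / b') ^ (m - 1))"
  proof -
    have "coeff (\<Sum>i\<le>K. monom (C i) i) m = C m"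
      by (simp add: coeff_sum K_def)
    moreover have "coeff (monom 1 1 * p) m = coeff p (m - 1)" for p :: "real poly"
      using assms(1) by (simp add: coeff_monom_mult)
    moreover have "coeff (monom 1 i * p) m = (if i \<le> m then coeff p (m - i) else 0)" for i and p :: "real poly"
      by (simp add: coeff_monom_mult)
    moreover have "coeff (monom \<tau> 1) m = (if m = 1 then \<tau> else 0)"
      by auto
    ultimately show ?thesis
      unfolding W_def sumQ[symmetric] coeff_add coeff_diff coeff_smult coeff_sum by (simp only: coeff_monom)
  qed
  with \<open>coeff W m = 0\<close> have main: "sc * C m = - (sa * (\<Sum>i\<le>n. A i * (real ((K - 1 - i) choose (m - 1)) * (- a' / c') ^ (m - 1) * (- b' / c') ^ (n - i))))
    - sb * (\<Sum>i\<le>m. B i * (real ((K - 1 - i) choose (n - 1)) * (- a' / c') ^ (m - i) * (- b' / c') ^ (n - 1)))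
    + c' * q / (a' * b') * ((- 1 / a') ^ (n - 1) * (1 / b') ^ (m - 1)) - (if m = 1 then \<tau> else 0)"
    unfolding sumA sumB by linarith

  \<comment> \<open>Normalisation of factorials and signs\<close>
  have signs: "(- u / c') ^ k * (- v / c') ^ l = - ((- 1) ^ Suc (k + l) * u ^ k * v ^ l / c' ^ (k + l))" for u v k l
    by (simp add: power_divide power_add power_minus[of "u / c'"] power_minus[of "v / c'"])
  have TA: "fact m * fact n * (\<Sum>i\<le>n. A i * (real ((K - 1 - i) choose (m - 1)) * (- a' / c') ^ (m - 1) * (- b' / c') ^ (n - i)))
     = - (real m * a' ^ (m - 1) * (\<Sum>j = 0..n. real (n choose j) *
           ((-1) ^ (m + n - j) * b' ^ (n - j) / (c' ^ (m + n - j - 1) * real (m + n - j))) *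
           dr_sum j (m + n - j) b c a y z x))"
    unfolding sum_distrib_left sum_negf[symmetric] atLeast0AtMost
  proof (rule sum.cong[OF refl])
    fix i assume "i \<in> {..n}"
    then have i: "i \<le> n" by simp
    \<comment> \<open>The exponents add up to one less than the m + n - i that governs the sign in
      the theorem; hence the \<open>Suc\<close> and the leading minus in
      \<open>signs\<close>.\<close>
    have e: "m - 1 + (n - i) = m + n - i - 1" "Suc (m + n - i - 1) = m + n - i" using i assms by auto
    have "fact m * fact n * (A i * (real ((K - 1 - i) choose (m - 1)) * (- a' / c') ^ (m - 1) * (- b' / c') ^ (n - i)))
      = (fact m * fact n * (A i * real ((m + n - 1 - i) choose (m - 1)))) * ((- a' / c') ^ (m - 1) * (- b' / c') ^ (n - i))"
      by (simp add: K_def mult_ac)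
    also have "fact m * fact n * (A i * real ((m + n - 1 - i) choose (m - 1)))
        = real m * real (n choose i) * dr_sum i (m + n - i) b c a y z x / real (m + n - i)"
      unfolding A_def K_def by (rule factorial_weight[OF assms(1) i])
    finally show "fact m * fact n * (A i * (real ((K - 1 - i) choose (m - 1)) * (- a' / c') ^ (m - 1) * (- b' / c') ^ (n - i)))
     = - (real m * a' ^ (m - 1) * (real (n choose i) *
           ((-1) ^ (m + n - i) * b' ^ (n - i) / (c' ^ (m + n - i - 1) * real (m + n - i))) *
           dr_sum i (m + n - i) b c a y z x))"
      unfolding signs e by (simp add: mult_ac)
  qed
  have TB: "fact m * fact n * (\<Sum>i\<le>m. B i * (real ((K - 1 - i) choose (n - 1)) * (- a' / c') ^ (m - i) * (- b' / c') ^ (n - 1)))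
     = - (real n * b' ^ (n - 1) * (\<Sum>j = 0..m. real (m choose j) *
           ((-1) ^ (m + n - j) * a' ^ (m - j) / (c' ^ (m + n - j - 1) * real (m + n - j))) *
           dr_sum j (m + n - j) a c b x z y))"
    unfolding sum_distrib_left sum_negf[symmetric] atLeast0AtMost
  proof (rule sum.cong[OF refl])
    fix i assume "i \<in> {..m}"
    then have i: "i \<le> m" by simp
    have e: "m - i + (n - 1) = m + n - i - 1" "Suc (m + n - i - 1) = m + n - i" using i assms by auto
    have "fact m * fact n * (B i * (real ((K - 1 - i) choose (n - 1)) * (- a' / c') ^ (m - i) * (- b' / c') ^ (n - 1)))
      = (fact n * fact m * (B i * real ((n + m - 1 - i) choose (n - 1)))) * ((- a' / c') ^ (m - i) * (- b' / c') ^ (n - 1))"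
      by (simp add: K_def mult_ac add.commute)
    also have "fact n * fact m * (B i * real ((n + m - 1 - i) choose (n - 1)))
        = real n * real (m choose i) * dr_sum i (m + n - i) a c b x z y / real (m + n - i)"
      unfolding B_def K_def add.commute[of m n] by (rule factorial_weight[OF assms(2) i])
    finally show "fact m * fact n * (B i * (real ((K - 1 - i) choose (n - 1)) * (- a' / c') ^ (m - i) * (- b' / c') ^ (n - 1)))
     = - (real n * b' ^ (n - 1) * (real (m choose i) *
           ((-1) ^ (m + n - i) * a' ^ (m - i) / (c' ^ (m + n - i - 1) * real (m + n - i))) *
           dr_sum i (m + n - i) a c b x z y))"
      unfolding signs e by (simp add: mult_ac)
  qed
  have TQ: "fact m * fact n * (c' * q / (a' * b') * ((- 1 / a') ^ (n - 1) * (1 / b') ^ (m - 1)))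
    = (-1) ^ (n - 1) * fact m * fact n * c' * (q * fact K) / (a' ^ n * b' ^ m * fact K)"
    using assms nz by (simp add: power_minus[of "1 / a'"] power_divide power_eq_if[of a' n] power_eq_if[of b' m] mult_ac)
  \<comment> \<open>m = 1 and K = 2 force n = 1, and then both factorials are 1.\<close>
  have T\<tau>: "fact m * fact n * (if m = 1 then \<tau> else 0) = sc * (kronecker 1 m * kronecker 1 n * (sa * sb) * (N / 4))"
    using assms by (auto simp: \<tau>_def kronecker_def K_def)
  have "sc * sc = 1" using assms(5) by (simp add: sc_def sgn_if)
  then have "dr_sum m n a b c x y z = sc * (fact m * fact n * (sc * C m))"
    by (simp add: C_def K_def flip: mult.assoc)
  also have "\<dots> = sc * (
      sa * - (fact m * fact n * (\<Sum>i\<le>n. A i * (real ((K - 1 - i) choose (m - 1)) * (- a' / c') ^ (m - 1) * (- b' / c') ^ (n - i))))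
    + sb * - (fact m * fact n * (\<Sum>i\<le>m. B i * (real ((K - 1 - i) choose (n - 1)) * (- a' / c') ^ (m - i) * (- b' / c') ^ (n - 1))))
    + fact m * fact n * (c' * q / (a' * b') * ((- 1 / a') ^ (n - 1) * (1 / b') ^ (m - 1)))
    - fact m * fact n * (if m = 1 then \<tau> else 0))"
    unfolding main by algebra
  finally have final: "dr_sum m n a b c x y z = sc * (
      sa * (real m * a' ^ (m - 1) * (\<Sum>j = 0..n. real (n choose j) *
           ((-1) ^ (m + n - j) * b' ^ (n - j) / (c' ^ (m + n - j - 1) * real (m + n - j))) *
           dr_sum j (m + n - j) b c a y z x))
    + sb * (real n * b' ^ (n - 1) * (\<Sum>j = 0..m. real (m choose j) *
           ((-1) ^ (m + n - j) * a' ^ (m - j) / (c' ^ (m + n - j - 1) * real (m + n - j))) *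
           dr_sum j (m + n - j) a c b x z y))
    + (-1) ^ (n - 1) * fact m * fact n * c' * (q * fact K) / (a' ^ n * b' ^ m * fact K)
    - sc * (kronecker 1 m * kronecker 1 n * (sa * sb) * (N / 4)))"
    unfolding TA TB TQ T\<tau> minus_minus .
  have qK: "q * fact K = of_int (gcd a b) ^ (m + n) * bernoulli_fun (m + n) ((of_int a * y - of_int b * x) / of_int (gcd a b))"
    by (simp add: q_def K_def)
  have sgns: "real_of_int (sgn (b * c)) = sb * sc" "real_of_int (sgn (a * c)) = sa * sc" "real_of_int (sgn (a * b)) = sa * sb"
    by (simp_all add: sgn_mult sa_def sb_def sc_def)
  \<comment> \<open>The outer sgn c enters the first three terms and cancels against its own copy in
    the triple term.\<close>
  have combine: "sc * (sa * (t1 * t2 * X) + sb * (t3 * t4 * Y) + t5 * t6 * t7 * t8 * (t9 * u) / d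
        - sc * (k * l * (sa * sb) * T))
      = t3 * t4 * (sb * sc) * Y + t1 * t2 * (sa * sc) * X + t5 * t6 * t7 * t8 * t9 * sc * u / d
        - k * l * (sa * sb) * T" for t1 t2 t3 t4 t5 t6 t7 t8 t9 u d k l X Y T
    using \<open>sc * sc = 1\<close> unfolding divide_inverse by algebra
  show ?thesis
    using final[unfolded qK, unfolded K_def combine]
    unfolding sgns a'_def b'_def c'_def N_def unfolding sa_def sb_def sc_def .
qed

end
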